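(* For any $R\in\mathcal{M}_r$, define the linear operator $P:\mathbb{R}^{m\times r}\to\mathbb{R}^{m\times r}$ by $$P(\lambda):=AA^\top\lambda-A\operatorname{diag}_B^*\Big(\operatorname{diag}_B\big(A^\top\lambda(2R-ee_1^\top)^\top\big)\Big)(2R-ee_1^\top),\qquad\lambda\in\mathbb{R}^{m\times r}.$$ Then the following statements are equivalent: 1. The point $R$ is regular. 2. The operator $h_R^*:\mathbb{R}^{m\times r}\times\mathbb{R}^{|B|}\to\mathbb{R}^{n\times r}$, $h_R^*(\lambda,\mu)=A^\top\lambda+\operatorname{diag}_B^*(\mu)(2R-ee_1^\top)$, is injective. 3. The operator $P$ is positive definite, i.e. $\langle\lambda,P(\lambda)\rangle>0$ for all non-zero $\lambda\in\mathbb{R}^{m\times r}$.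
   Context: $n,m,r$ are positive integers, $A\in\mathbb{R}^{m\times n}$ has full row rank, $b\in\mathbb{R}^m$ with $b\ge0$, $B\subseteq[n]=\{1,\dots,n\}$. $e\in\mathbb{R}^n$ is the all-ones vector, $e_1\in\mathbb{R}^r$ the first standard unit vector, $\langle X,Y\rangle=\operatorname{Tr}(XY^\top)$. $\operatorname{diag}_B(X)=(X_{ii})_{i\in B}\in\mathbb{R}^{|B|}$ for $X\in\mathbb{R}^{n\times n}$; its adjoint $\operatorname{diag}_B^*(\mu)\in\mathbb{R}^{n\times n}$ is the diagonal matrix with the entries of $\mu$ at positions in $B$ and $0$ elsewhere. $R_B$ is the submatrix of rows of $R$ indexed by $B$. $\mathcal{M}_r=\{R\in\mathbb{R}^{n\times r}: AR=be_1^\top,\ \operatorname{diag}_B(RR^\top)-R_Be_1=0\}$. A point $R\in\mathcal{M}_r$ is called regular if it satisfies the linear independence constraint qualification (LICQ): the gradients at $R$ of the $mr+|B|$ scalar equality constraint functions (the entries of $AR-be_1^\top$ and of $\operatorname{diag}_B(RR^\top)-R_Be_1$) are linearly independent. The differential of the constraints at $R$ is $h_R(H)=(AH;\,2\operatorname{diag}_B(HR^\top)-H_Be_1)$, and $h_R^*$ is its adjoint. *)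

theory Defs
  imports "HOL-Analysis.Analysis"
begin

(* The index types 'm, 'n, 'r play the roles of [m], [n], [r]; [r] carries a linear order so that
   it has a first element. The set B may be empty, hence cannot be a type: |B|-dimensional vectors
   are vectors of real^'n vanishing off B (coords B), and the submatrix of the rows in B keeps
   its place in real^'r^'n, the other rows being zero. *)

definition e1 :: "real^'r::{finite,linorder}" where
  "e1 = axis (Min UNIV) 1"

definition outer :: "real^'a \<Rightarrow> real^'b \<Rightarrow> real^'b^'a" where
  "outer u v = (\<chi> i j. u$i * v$j)"

definition frob :: "real^'b^'a \<Rightarrow> real^'b^'a \<Rightarrow> real" where
  "frob X Y = trace (X ** transpose Y)"

definition coords :: "'n set \<Rightarrow> (real^'n) set" where
  "coords B = {\<mu>. \<forall>i. i \<notin> B \<longrightarrow> \<mu>$i = 0}"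

definition diagB :: "'n set \<Rightarrow> real^'n^'n \<Rightarrow> real^'n" where
  "diagB B X = (\<chi> i. if i \<in> B then X$i$i else 0)"

definition diagB_adj :: "'n set \<Rightarrow> real^'n \<Rightarrow> real^'n^'n" where
  "diagB_adj B \<mu> = (\<chi> i j. if i = j \<and> i \<in> B then \<mu>$i else 0)"

definition rowsB :: "'n set \<Rightarrow> real^'r^'n \<Rightarrow> real^'r^'n" where
  "rowsB B R = (\<chi> i. if i \<in> B then R$i else 0)"

definition lin_constr :: "real^'n^'m \<Rightarrow> real^'m \<Rightarrow> real^'r::{finite,linorder}^'n \<Rightarrow> real^'r::{finite,linorder}^'m" where
  "lin_constr A b R = A ** R - outer b e1"

definition diag_constr :: "'n set \<Rightarrow> real^'r::{finite,linorder}^'n \<Rightarrow> real^'n" where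
  "diag_constr B R = diagB B (R ** transpose R) - rowsB B R *v e1"

definition feasible :: "real^'n^'m \<Rightarrow> real^'m \<Rightarrow> 'n set \<Rightarrow> (real^'r::{finite,linorder}^'n) set" where
  "feasible A b B = {R. A ** R = outer b e1 \<and> diag_constr B R = 0}"

definition gradient :: "('a::real_inner \<Rightarrow> real) \<Rightarrow> 'a \<Rightarrow> 'a" where
  "gradient f x = (THE g. GDERIV f x :> g)"

fun constr :: "real^'n^'m \<Rightarrow> real^'m \<Rightarrow> 'n set \<Rightarrow> ('m \<times> 'r::{finite,linorder}) + 'n \<Rightarrow>
    real^'r::{finite,linorder}^'n \<Rightarrow> real" where
  "constr A b B (Inl (i, j)) R = lin_constr A b R $ i $ j"
| "constr A b B (Inr k) R = diag_constr B R $ k"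

(* The library predicate independent speaks about sets; linear independence of the indexed family
   of gradients additionally requires that no two constraints share a gradient. *)

definition regular :: "real^'n^'m \<Rightarrow> real^'m \<Rightarrow> 'n set \<Rightarrow> real^'r::{finite,linorder}^'n \<Rightarrow> bool" where
  "regular A b B R \<longleftrightarrow>
     (let I = (UNIV :: ('m \<times> 'r::{finite,linorder}) set) <+> B; g = (\<lambda>c. gradient (constr A b B c) R)
      in inj_on g I \<and> independent (g ` I))"

definition h :: "real^'n^'m \<Rightarrow> 'n set \<Rightarrow> real^'r::{finite,linorder}^'n \<Rightarrow> real^'r::{finite,linorder}^'n \<Rightarrow>
    (real^'r::{finite,linorder}^'m) \<times> (real^'n)" where
  "h A B R H = (A ** H, 2 *\<^sub>R diagB B (H ** transpose R) - rowsB B H *v e1)"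

definition h_adj :: "real^'n^'m \<Rightarrow> 'n set \<Rightarrow> real^'r::{finite,linorder}^'n \<Rightarrow>
    (real^'r::{finite,linorder}^'m) \<times> (real^'n) \<Rightarrow> real^'r::{finite,linorder}^'n" where
  "h_adj A B R = (\<lambda>(l, \<mu>). transpose A ** l + diagB_adj B \<mu> ** (2 *\<^sub>R R - outer 1 e1))"

definition P_op :: "real^'n^'m \<Rightarrow> 'n set \<Rightarrow> real^'r::{finite,linorder}^'n \<Rightarrow>
    real^'r::{finite,linorder}^'m \<Rightarrow> real^'r::{finite,linorder}^'m" where
  "P_op A B R l = A ** transpose A ** l
     - A ** diagB_adj B (diagB B (transpose A ** l ** transpose (2 *\<^sub>R R - outer 1 e1)))
         ** (2 *\<^sub>R R - outer 1 e1)"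

definition pos_def_op :: "(real^'b^'a \<Rightarrow> real^'b^'a) \<Rightarrow> bool" where
  "pos_def_op T \<longleftrightarrow> (\<forall>l. l \<noteq> 0 \<longrightarrow> frob l (T l) > 0)"

lemma frob_eq_inner: "frob X Y = X \<bullet> Y"
  by (simp add: frob_def trace_def matrix_matrix_mult_def transpose_def inner_vec_def)

lemma gradient_eq:
  assumes "GDERIV f x :> g"
  shows "gradient f x = g"
proof -
  have "g' = g" if "GDERIV f x :> g'" for g'
  proof -
    have "(\<lambda>v. v \<bullet> g') = (\<lambda>v. v \<bullet> g)"
      using that assms unfolding gderiv_def by (rule has_derivative_unique)
    then have "(g' - g) \<bullet> g' = (g' - g) \<bullet> g" by meson
    then have "(g' - g) \<bullet> (g' - g) = 0" by (simp only: inner_diff_right)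
    then show ?thesis by simp
  qed
  then show ?thesis unfolding gradient_def using assms by blast
qed

lemma diagB_in_coords: "diagB B X \<in> coords B"
  by (simp add: coords_def diagB_def)

lemma diag_constr_in_coords: "diag_constr B R \<in> coords B"
  by (simp add: coords_def diag_constr_def diagB_def rowsB_def matrix_vector_mult_def)

lemma diagB_adjoint:
  fixes B :: "'n::finite set"
  shows "adjoint (diagB B) = diagB_adj B"
proof (rule adjoint_unique, intro allI)
  fix X :: "real^'n^'n" and \<mu> :: "real^'n"
  have "(\<Sum>j\<in>UNIV. X$i$j * (if i = j \<and> i \<in> B then \<mu>$i else 0))
      = (if i \<in> B then X$i$i * \<mu>$i else 0)" for i
    by (cases "i \<in> B") (simp_all add: if_distrib[where f = "\<lambda>t. _ * t"] cong: if_cong)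
  then show "diagB B X \<bullet> \<mu> = X \<bullet> diagB_adj B \<mu>"
    unfolding inner_vec_def diagB_def diagB_adj_def
    by (simp add: if_distrib[where f = "\<lambda>t. t * _"] cong: if_cong)
qed

lemma h_adj_component:
  fixes A :: "real^'n^'m" and R :: "real^'r::{finite,linorder}^'n"
  shows "h_adj A B R (l, \<mu>) $ i $ j
     = (transpose A ** l)$i$j + (if i \<in> B then \<mu>$i * (2 * R$i$j - e1$j) else 0)"
proof -
  have "(diagB_adj B \<mu> ** (2 *\<^sub>R R - outer 1 e1))$i$j
      = (\<Sum>k\<in>UNIV. if i = k then (if i \<in> B then \<mu>$i * (2 * R$i$j - e1$j) else 0) else 0)"
    by (auto simp: matrix_matrix_mult_def diagB_adj_def outer_def if_distrib[where f = "\<lambda>t. t * _"]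
        simp del: sum.delta sum.delta' intro!: sum.cong)
  then show ?thesis by (simp add: h_adj_def)
qed

lemma h_adjoint:
  fixes A :: "real^'n^'m" and R :: "real^'r::{finite,linorder}^'n"
  shows "adjoint (h A B R) = h_adj A B R"
proof (rule adjoint_unique, intro allI)
  fix H :: "real^'r::{finite,linorder}^'n" and p :: "(real^'r::{finite,linorder}^'m) \<times> (real^'n)"
  obtain l \<mu> where p: "p = (l, \<mu>)" by fastforce
  have 1: "(A ** H) \<bullet> l = H \<bullet> (transpose A ** l)"
  proof -
    have "(A ** H) \<bullet> l = (\<Sum>i\<in>UNIV. \<Sum>j\<in>UNIV. \<Sum>k\<in>UNIV. A$i$k * H$k$j * l$i$j)"
      by (simp add: inner_vec_def matrix_matrix_mult_def sum_distrib_right)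
    also have "\<dots> = (\<Sum>i\<in>UNIV. \<Sum>k\<in>UNIV. \<Sum>j\<in>UNIV. A$i$k * H$k$j * l$i$j)"
      by (rule sum.cong[OF refl], rule sum.swap)
    also have "\<dots> = (\<Sum>k\<in>UNIV. \<Sum>i\<in>UNIV. \<Sum>j\<in>UNIV. A$i$k * H$k$j * l$i$j)"
      by (rule sum.swap)
    also have "\<dots> = (\<Sum>k\<in>UNIV. \<Sum>j\<in>UNIV. \<Sum>i\<in>UNIV. A$i$k * H$k$j * l$i$j)"
      by (rule sum.cong[OF refl], rule sum.swap)
    also have "\<dots> = H \<bullet> (transpose A ** l)"
      by (simp add: inner_vec_def matrix_matrix_mult_def transpose_def sum_distrib_left mult_ac)
    finally show ?thesis .
  qed
  have 2: "(2 *\<^sub>R diagB B (H ** transpose R) - rowsB B H *v e1)$i * \<mu>$i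
      = (\<Sum>j\<in>UNIV. H$i$j * (if i \<in> B then \<mu>$i * (2 * R$i$j - e1$j) else 0))" for i
    by (cases "i \<in> B")
      (simp_all add: diagB_def rowsB_def matrix_vector_mult_def matrix_matrix_mult_def transpose_def
        sum_distrib_left sum_distrib_right algebra_simps sum_subtractf)
  have "H \<bullet> h_adj A B R p = (\<Sum>i\<in>UNIV. \<Sum>j\<in>UNIV. H$i$j * (transpose A ** l)$i$j)
      + (\<Sum>i\<in>UNIV. \<Sum>j\<in>UNIV. H$i$j * (if i \<in> B then \<mu>$i * (2 * R$i$j - e1$j) else 0))"
    unfolding p inner_vec_def h_adj_component by (simp add: distrib_left sum.distrib)
  also have "\<dots> = H \<bullet> (transpose A ** l)
      + (2 *\<^sub>R diagB B (H ** transpose R) - rowsB B H *v e1) \<bullet> \<mu>"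
    by (simp add: inner_vec_def 2[symmetric])
  finally show "h A B R H \<bullet> p = H \<bullet> h_adj A B R p"
    unfolding p h_def inner_Pair 1 by simp
qed

lemma h_has_derivative:
  fixes A :: "real^'n^'m" and R :: "real^'r::{finite,linorder}^'n"
  shows "((\<lambda>R. (lin_constr A b R, diag_constr B R)) has_derivative h A B R) (at R)"
proof -
  have comp: "((\<lambda>R::real^'r::{finite,linorder}^'n. R$i$j) has_derivative (\<lambda>H. H$i$j)) F" for i j F
    by (intro bounded_linear_imp_has_derivative
        bounded_linear_compose[OF bounded_linear_vec_nth bounded_linear_vec_nth])
  have 1: "(lin_constr A b has_derivative (\<lambda>H. A ** H)) (at R)"
    unfolding lin_constr_def outer_def matrix_matrix_mult_def
    apply (subst has_derivative_componentwise_within)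
    apply (auto simp: Basis_vec_def inner_axis)
    by (auto intro!: derivative_eq_intros comp)
  have 2: "((\<lambda>R. diag_constr B R $ k) has_derivative
      (\<lambda>H. (2 *\<^sub>R diagB B (H ** transpose R) - rowsB B H *v e1) $ k)) (at R)" for k
  proof (cases "k \<in> B")
    case True
    then show ?thesis
      unfolding diag_constr_def diagB_def rowsB_def matrix_matrix_mult_def matrix_vector_mult_def
        transpose_def
      by (auto intro!: derivative_eq_intros comp
          simp: sum_distrib_left sum.distrib[symmetric] algebra_simps)
  next
    case False
    then show ?thesis
      by (simp add: diag_constr_def diagB_def rowsB_def matrix_vector_mult_def)
  qed
  have "(diag_constr B has_derivative
      (\<lambda>H. 2 *\<^sub>R diagB B (H ** transpose R) - rowsB B H *v e1)) (at R)"
    using 2 by (subst has_derivative_componentwise_within) (auto simp: Basis_vec_def inner_axis)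
  from has_derivative_Pair[OF 1 this] show ?thesis
    unfolding h_def[abs_def] .
qed

end

theory Submission
  imports Defs
begin

text \<open>
  Write \<open>W = 2R - e e\<^sub>1\<^sup>T\<close>. The equivalence of regularity with injectivity of \<open>h\<^sub>R\<^sup>*\<close> is linear algebra:
  the scalar constraints are the coordinates of the vector-valued constraint map, whose differential
  is \<open>h\<^sub>R\<close>, so their gradients are the images under \<open>h\<^sub>R\<^sup>*\<close> of the standard unit vectors of the
  multiplier space (lemma \<open>gradient_constr\<close>). These unit vectors form a basis of
  \<open>\<real>\<^sup>m\<^sup>\<times>\<^sup>r \<times> \<real>\<^sup>|\<^sup>B\<^sup>|\<close>, and a linear map is injective on the span of a basis iff it keeps the basis
  vectors distinct and independent.

  The equivalence with positive definiteness of \<open>P\<close> rests on one consequence of feasibility: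
  completing the square, \<open>|w\<^sub>i|\<^sup>2 = 4 (|R\<^sub>i|\<^sup>2 - R\<^sub>i e\<^sub>1) + 1 = 1\<close> for the row \<open>w\<^sub>i\<close> of \<open>W\<close> with \<open>i \<in> B\<close>.
  Hence in row \<open>i \<in> B\<close> the vector \<open>\<mu>\<^sub>i w\<^sub>i\<close> lies on the line spanned by a unit vector, and Pythagoras
  gives \<open>|h\<^sub>R\<^sup>*(\<lambda>,\<mu>)|\<^sup>2 = \<langle>\<lambda>, P(\<lambda>)\<rangle> + |\<mu> + d(\<lambda>)|\<^sup>2\<close> with \<open>d(\<lambda>) = diag\<^sub>B(A\<^sup>T\<lambda> W\<^sup>T)\<close>
  (lemma \<open>h_adj_Pythagoras\<close>). In other words \<open>\<langle>\<lambda>, P(\<lambda>)\<rangle>\<close> is the minimum of \<open>|h\<^sub>R\<^sup>*(\<lambda>,\<mu>)|\<^sup>2\<close> over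
  \<open>\<mu>\<close>, so \<open>P\<close> is the Schur complement of \<open>h\<^sub>R h\<^sub>R\<^sup>*\<close> obtained by eliminating \<open>\<mu>\<close>. This minimum is
  positive for all \<open>\<lambda> \<noteq> 0\<close> iff no \<open>(\<lambda>, \<mu>)\<close> with \<open>\<lambda> \<noteq> 0\<close> lies in the kernel; and \<open>h\<^sub>R\<^sup>*(0,\<mu>)\<close>
  has norm \<open>|\<mu>|\<close>, so it never vanishes for \<open>\<mu> \<noteq> 0\<close>.
\<close>

lemma linear_h: "linear (h A B R)"
  using has_derivative_linear[OF h_has_derivative] .

lemma linear_h_adj: "linear (h_adj A B R)"
  using adjoint_linear[OF linear_h] by (simp add: h_adjoint)

fun multiplier_unit :: "('m \<times> 'r) + 'n \<Rightarrow> (real^'r^'m) \<times> (real^'n)" where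
  "multiplier_unit (Inl (i, j)) = (axis i (axis j 1), 0)"
| "multiplier_unit (Inr k) = (0, axis k 1)"

lemma multiplier_unit_in_Basis: "multiplier_unit c \<in> Basis"
  by (cases c rule: multiplier_unit.cases)
    (auto simp: Basis_prod_def Basis_vec_def)

lemma inj_multiplier_unit: "inj multiplier_unit"
proof (rule injI)
  fix c d :: "('m::finite \<times> 'r::finite) + 'n::finite"
  assume "multiplier_unit c = multiplier_unit d"
  then show "c = d"
    by (cases c rule: multiplier_unit.cases; cases d rule: multiplier_unit.cases)
      (auto simp: axis_eq_axis axis_eq_0_iff)
qed

lemma span_multiplier_units:
  "span (multiplier_unit ` (UNIV <+> B)) = UNIV \<times> coords B"
proof -
  let ?E = "multiplier_unit ` (UNIV <+> B)"
  have "?E \<subseteq> Basis"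
    using multiplier_unit_in_Basis by blast
  note span = span_substd_basis[OF this]
  have Inr: "multiplier_unit (Inr k) \<in> ?E \<longleftrightarrow> k \<in> B" for k
    using inj_image_mem_iff[OF inj_multiplier_unit, of "Inr k" "UNIV <+> B"] by auto
  have "(l, \<mu>) \<in> span ?E \<longleftrightarrow> \<mu> \<in> coords B" for l \<mu>
  proof
    assume "(l, \<mu>) \<in> span ?E"
    then have "(l, \<mu>) \<bullet> multiplier_unit (Inr k) = 0" if "k \<notin> B" for k
      using that Inr multiplier_unit_in_Basis unfolding span by blast
    then show "\<mu> \<in> coords B"
      by (simp add: coords_def inner_axis)
  next
    assume "\<mu> \<in> coords B"
    moreover have "v \<in> ?E \<or> (\<exists>k. k \<notin> B \<and> v = (0, axis k 1))"
      if "v \<in> Basis" for v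
    proof -
      from that consider i j where "v = multiplier_unit (Inl (i, j))"
        | k where "v = multiplier_unit (Inr k)"
        by (auto simp: Basis_prod_def Basis_vec_def)
      then show ?thesis
      proof cases
        case 1
        then show ?thesis by blast
      next
        case 2
        then show ?thesis using Inr by auto
      qed
    qed
    ultimately show "(l, \<mu>) \<in> span ?E"
      unfolding span by (fastforce simp: coords_def inner_axis)
  qed
  then show ?thesis
    by auto
qed

text \<open>A scalar constraint is the inner product of the constraint map with a unit vector, so moving
  the differential to the other side of the inner product exhibits the gradient.\<close>

lemma gradient_constr: "gradient (constr A b B c) R = h_adj A B R (multiplier_unit c)"
proof (rule gradient_eq)
  have "constr A b B c = (\<lambda>R. (lin_constr A b R, diag_constr B R) \<bullet> multiplier_unit c)"
    by (cases c rule: multiplier_unit.cases) (auto simp: inner_axis fun_eq_iff)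
  moreover have "((\<lambda>R. (lin_constr A b R, diag_constr B R) \<bullet> multiplier_unit c) has_derivative
      (\<lambda>H. h A B R H \<bullet> multiplier_unit c)) (at R)"
    by (rule has_derivative_inner_left[OF h_has_derivative])
  moreover have "h A B R H \<bullet> multiplier_unit c = H \<bullet> h_adj A B R (multiplier_unit c)" for H
    using adjoint_works[OF linear_h[of A B R], of H "multiplier_unit c"]
    by (simp add: h_adjoint inner_commute)
  ultimately show "GDERIV (constr A b B c) R :> h_adj A B R (multiplier_unit c)"
    by (simp add: gderiv_def)
qed

theorem regular_iff_inj_h_adj:
  fixes A :: "real^'n^'m" and R :: "real^'r::{finite,linorder}^'n"
  shows "regular A b B R \<longleftrightarrow> inj_on (h_adj A B R) (UNIV \<times> coords B)"
proof -
  let ?I = "UNIV <+> B" and ?f = "h_adj A B R"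
  let ?E = "multiplier_unit ` ?I"
  have "regular A b B R \<longleftrightarrow>
      inj_on (?f \<circ> multiplier_unit) ?I \<and> independent ((?f \<circ> multiplier_unit) ` ?I)"
    by (simp add: regular_def Let_def gradient_constr comp_def)
  also have "\<dots> \<longleftrightarrow> inj_on ?f ?E \<and> independent (?f ` ?E)"
    using inj_on_subset[OF inj_multiplier_unit subset_UNIV]
    by (auto simp: image_comp intro: comp_inj_on dest: inj_on_imageI)
  also have "\<dots> \<longleftrightarrow> inj_on ?f (span ?E)"
  proof -
    have "independent ?E"
      by (rule independent_mono[OF independent_Basis]) (use multiplier_unit_in_Basis in blast)
    then show ?thesis
      using linear_inj_on_span_iff_independent_image[OF linear_h_adj[of A B R], of ?E]
        linear_independent_injective_image[OF linear_h_adj[of A B R], of ?E]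
        inj_on_subset[OF _ span_superset]
      by blast
  qed
  finally show ?thesis
    by (simp add: span_multiplier_units)
qed

lemma inner_matrix_mult_left:
  fixes A :: "real^'n^'m"
  shows "L \<bullet> (A ** X) = (transpose A ** L) \<bullet> X"
proof -
  have "trace (L ** transpose (A ** X)) = trace ((L ** transpose X) ** transpose A)"
    by (simp add: matrix_transpose_mul matrix_mul_assoc)
  also have "\<dots> = trace ((transpose A ** L) ** transpose X)"
    by (subst trace_mul_sym) (simp add: matrix_mul_assoc)
  finally show ?thesis
    by (simp add: frob_eq_inner[symmetric] frob_def)
qed

lemma matrix_mult_diff_right:
  fixes A :: "real^'n^'m"
  shows "A ** (X - Y) = A ** X - A ** Y"
  by (simp add: vec_eq_iff matrix_matrix_mult_def right_diff_distrib sum_subtractf)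

lemma diagB_adj_mult_row:
  "(diagB_adj B \<mu> ** W) $ i = (if i \<in> B then \<mu>$i *\<^sub>R W$i else 0)"
proof -
  have "(diagB_adj B \<mu> ** W) $ i $ j =
      (\<Sum>k\<in>UNIV. if k = i then (if i \<in> B then \<mu>$i * W$i$j else 0) else 0)" for j
    unfolding matrix_matrix_mult_def diagB_adj_def
    by (auto intro!: sum.cong simp del: sum.delta sum.delta')
  then show ?thesis
    by (simp add: vec_eq_iff)
qed

lemma diagB_mult_transpose:
  "diagB B (X ** transpose W) $ i = (if i \<in> B then X$i \<bullet> W$i else 0)"
  by (simp add: diagB_def matrix_matrix_mult_def transpose_def inner_vec_def)

lemma feasible_unit_rows:
  assumes "R \<in> feasible A b B" and "i \<in> B"
  shows "(2 *\<^sub>R R - outer 1 e1) $ i \<bullet> (2 *\<^sub>R R - outer 1 e1) $ i = 1"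
proof -
  have "diag_constr B R $ i = 0"
    using assms by (simp add: feasible_def)
  then have "R$i \<bullet> R$i = R$i \<bullet> e1"
    using assms(2)
    by (simp add: diag_constr_def diagB_mult_transpose rowsB_def matrix_vector_mult_def inner_vec_def)
  moreover have "(2 *\<^sub>R R - outer 1 e1) $ i = 2 *\<^sub>R R$i - e1"
    by (simp add: vec_eq_iff outer_def)
  moreover have "e1 \<bullet> e1 = 1"
    by (simp add: e1_def inner_axis_axis)
  ultimately show ?thesis
    by (simp add: inner_diff_left inner_diff_right inner_commute)
qed

text \<open>In a row \<open>i \<in> B\<close>, with \<open>a\<close> the row of \<open>A\<^sup>T\<lambda>\<close> and \<open>w\<close> the unit row of \<open>2R - e e\<^sub>1\<^sup>T\<close>, the claim
  is the orthogonal decomposition \<open>|a + \<mu>\<^sub>i w|\<^sup>2 = (|a|\<^sup>2 - (a \<cdot> w)\<^sup>2) + (\<mu>\<^sub>i + a \<cdot> w)\<^sup>2\<close>: the part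
  orthogonal to \<open>w\<close> is independent of \<open>\<mu>\<^sub>i\<close> and is what \<open>P\<close> measures.\<close>

lemma h_adj_Pythagoras:
  fixes A :: "real^'n^'m" and R :: "real^'r::{finite,linorder}^'n"
  assumes "R \<in> feasible A b B" and "\<mu> \<in> coords B"
  defines "d \<equiv> \<lambda>l. diagB B (transpose A ** l ** transpose (2 *\<^sub>R R - outer 1 e1))"
  shows "h_adj A B R (l, \<mu>) \<bullet> h_adj A B R (l, \<mu>) =
    frob l (P_op A B R l) + (\<mu> + d l) \<bullet> (\<mu> + d l)"
proof -
  define W where "W = 2 *\<^sub>R R - outer 1 e1"
  define a where "a = transpose A ** l"
  have d: "d l $ i = (if i \<in> B then a$i \<bullet> W$i else 0)" for i
    by (simp add: d_def diagB_mult_transpose W_def a_def)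
  have "P_op A B R l = A ** (a - diagB_adj B (d l) ** W)"
    by (simp add: P_op_def W_def a_def d_def matrix_mul_assoc matrix_mult_diff_right)
  then have P: "frob l (P_op A B R l) = (\<Sum>i\<in>UNIV. a$i \<bullet> (a$i - (diagB_adj B (d l) ** W)$i))"
    by (simp add: frob_eq_inner inner_matrix_mult_left flip: a_def) (simp add: inner_vec_def)
  have "(a$i + (diagB_adj B \<mu> ** W)$i) \<bullet> (a$i + (diagB_adj B \<mu> ** W)$i) =
      a$i \<bullet> (a$i - (diagB_adj B (d l) ** W)$i) + (\<mu>$i + d l $ i) * (\<mu>$i + d l $ i)" for i
  proof (cases "i \<in> B")
    case True
    then have "W$i \<bullet> W$i = 1"
      using feasible_unit_rows[OF assms(1)] by (simp add: W_def)
    with True show ?thesis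
      by (simp add: diagB_adj_mult_row d inner_add_left inner_add_right inner_diff_right
          inner_commute algebra_simps)
  next
    case False
    then show ?thesis
      using assms(2) by (simp add: diagB_adj_mult_row d coords_def)
  qed
  then have "(\<Sum>i\<in>UNIV. (a$i + (diagB_adj B \<mu> ** W)$i) \<bullet> (a$i + (diagB_adj B \<mu> ** W)$i)) =
      frob l (P_op A B R l) + (\<mu> + d l) \<bullet> (\<mu> + d l)"
    by (simp add: P inner_vec_def[of "\<mu> + d l"] sum.distrib)
  moreover have "h_adj A B R (l, \<mu>) = a + diagB_adj B \<mu> ** W"
    by (simp add: h_adj_def a_def W_def)
  ultimately show ?thesis
    by (simp add: inner_vec_def[of "a + _"])
qed

theorem inj_h_adj_iff_pos_def:
  fixes A :: "real^'n^'m" and R :: "real^'r::{finite,linorder}^'n"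
  assumes "R \<in> feasible A b B"
  shows "inj_on (h_adj A B R) (UNIV \<times> coords B) \<longleftrightarrow> pos_def_op (P_op A B R)"
proof -
  let ?f = "h_adj A B R"
  define d where "d = (\<lambda>l. diagB B (transpose A ** l ** transpose (2 *\<^sub>R R - outer 1 e1)))"
  have pythagoras: "?f (l, \<mu>) \<bullet> ?f (l, \<mu>) = frob l (P_op A B R l) + (\<mu> + d l) \<bullet> (\<mu> + d l)"
    if "\<mu> \<in> coords B" for l \<mu>
    using h_adj_Pythagoras[OF assms that] by (simp add: d_def)
  have "subspace (UNIV \<times> coords B :: ((real^'r::{finite,linorder}^'m) \<times> (real^'n)) set)"
    by (metis span_multiplier_units subspace_span)
  then have inj: "inj_on ?f (UNIV \<times> coords B) \<longleftrightarrow>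
      (\<forall>l. \<forall>\<mu>\<in>coords B. ?f (l, \<mu>) = 0 \<longrightarrow> l = 0 \<and> \<mu> = 0)"
    using linear_injective_on_subspace_0[OF linear_h_adj[of A B R], of "UNIV \<times> coords B"]
    by (auto simp: zero_prod_def)
  show ?thesis
  proof
    assume *: "inj_on ?f (UNIV \<times> coords B)"
    show "pos_def_op (P_op A B R)"
      unfolding pos_def_op_def
    proof (intro allI impI)
      fix l :: "real^'r::{finite,linorder}^'m"
      assume "l \<noteq> 0"
      \<comment> \<open>The multiplier \<open>- d l\<close> minimizes the norm of \<open>h\<^sub>R\<^sup>*(l, \<mu>)\<close> over \<open>\<mu>\<close>.\<close>
      have "- d l \<in> coords B"
        by (simp add: d_def coords_def diagB_def)
      with * \<open>l \<noteq> 0\<close> have "?f (l, - d l) \<noteq> 0"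
        unfolding inj by blast
      then show "frob l (P_op A B R l) > 0"
        using pythagoras[OF \<open>- d l \<in> coords B\<close>, of l] inner_gt_zero_iff[of "?f (l, - d l)"] by simp
    qed
  next
    assume *: "pos_def_op (P_op A B R)"
    show "inj_on ?f (UNIV \<times> coords B)"
      unfolding inj
    proof (intro allI ballI impI)
      fix l \<mu>
      assume \<mu>: "\<mu> \<in> coords B" and 0: "?f (l, \<mu>) = 0"
      have "frob l (P_op A B R l) \<le> 0"
        using pythagoras[OF \<mu>, of l] inner_ge_zero[of "\<mu> + d l"]
        unfolding 0 inner_zero_left by linarith
      then have "l = 0"
        using * unfolding pos_def_op_def by (meson not_less)
      moreover have "d 0 = 0"
        by (simp add: d_def diagB_def matrix_matrix_mult_def vec_eq_iff)
      ultimately show "l = 0 \<and> \<mu> = 0"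
        using pythagoras[OF \<mu>, of l] 0 by (simp add: frob_eq_inner)
    qed
  qed
qed

theorem proposition1:
  fixes A :: "real^'n^'m" and b :: "real^'m" and B :: "'n set"
    and R :: "real^'r::{finite,linorder}^'n"
  assumes "rank A = CARD('m)"
    and "b \<ge> 0"
    and "R \<in> feasible A b B"
  shows "(regular A b B R \<longleftrightarrow> inj_on (h_adj A B R) (UNIV \<times> coords B))
    \<and> (inj_on (h_adj A B R) (UNIV \<times> coords B) \<longleftrightarrow> pos_def_op (P_op A B R))"
  using regular_iff_inj_h_adj inj_h_adj_iff_pos_def[OF assms(3)] by blast

end
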